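(* Let $\mu$ be a Borel probability measure on $[0,1)$ and let $x\in[0,1)$ be irrational. (a) Assume that $\mu(B(x,|I_n(x)|))\asymp\mu(I_n(x))$. If $d_\mu(x)$ exists, then $\delta_\mu(x)$ exists and $\delta_\mu(x)=d_\mu(x)$. (b) If $\delta_\mu(x)$ and $\lambda(x)$ both exist, then $d_\mu(x)$ exists and $\delta_\mu(x)=d_\mu(x)$.
   Context: $a_n(x)$ denotes the $n$-th partial quotient of the continued fraction of $x$; $I_n(x)=\{y\in[0,1):a_j(y)=a_j(x),\ 1\le j\le n\}$ is the $n$-th order cylinder containing $x$, an interval of length $|I_n(x)|$; $B(x,r)$ is the ball with center $x$ and radius $r$. The pointwise dimension and the Markov pointwise dimension of $\mu$ at $x$ are $$d_\mu(x)=\lim_{r\to0}\frac{\log\mu(B(x,r))}{\log r},\qquad\delta_\mu(x)=\lim_{n\to\infty}\frac{\log\mu(I_n(x))}{\log|I_n(x)|},$$ when the limits exist. The Lyapunov exponent is $\lambda(x)=\lim_{n\to\infty}\frac1n\log|(T^n)'(x)|$ when the (finite) limit exists, where $T(x)=\frac1x\pmod1$ is the Gauss map. For sequences, $u_n\asymp v_n$ means there are positive constants $c_1,c_2$ with $c_1v_n\le u_n\le c_2v_n$ for all $n$ large enough. *)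

theory Defs
  imports "HOL-Probability.Probability"
begin

text \<open>Since \<^term>\<open>1 / 0 = (0 :: real)\<close>, the point 0 is fixed by the Gauss map, and the partial
  quotients of a rational number are 0 once its finite expansion has ended.\<close>

definition gauss_map :: "real \<Rightarrow> real" where
  "gauss_map x = frac (1 / x)"

definition partial_quotient :: "nat \<Rightarrow> real \<Rightarrow> int" where
  "partial_quotient n x = \<lfloor>1 / (gauss_map ^^ (n - 1)) x\<rfloor>"

definition cylinder :: "nat \<Rightarrow> real \<Rightarrow> real set" where
  "cylinder n x = {y \<in> {0..<1}. \<forall>j\<in>{1..n}. partial_quotient j y = partial_quotient j x}"

definition cylinder_length :: "nat \<Rightarrow> real \<Rightarrow> real" where
  "cylinder_length n x = measure lborel (cylinder n x)"

text \<open>The real logarithm satisfies \<^term>\<open>ln 0 = (0 :: real)\<close>. For null sets the dimension quotients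
  need \<open>log 0 = -\<infinity>\<close> instead, so that they take the value \<open>\<infinity>\<close> there.\<close>

definition ext_ln :: "real \<Rightarrow> ereal" where
  "ext_ln t = (if t = 0 then - \<infinity> else ereal (ln t))"

text \<open>Balls are taken in the space that carries the measure.\<close>

definition ball_measure :: "real measure \<Rightarrow> real \<Rightarrow> real \<Rightarrow> real" where
  "ball_measure M x r = measure M (ball x r \<inter> space M)"

text \<open>The limits defining the dimensions are taken in the extended reals, so the value \<open>\<infinity>\<close> is
  allowed; the Lyapunov exponent is required to be finite.\<close>

definition pointwise_quotient :: "real measure \<Rightarrow> real \<Rightarrow> real \<Rightarrow> ereal" where
  "pointwise_quotient M x r = ext_ln (ball_measure M x r) / ereal (ln r)"

definition pointwise_dim_exists :: "real measure \<Rightarrow> real \<Rightarrow> bool" where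
  "pointwise_dim_exists M x \<longleftrightarrow> (\<exists>d. (pointwise_quotient M x \<longlongrightarrow> d) (at_right 0))"

definition pointwise_dim :: "real measure \<Rightarrow> real \<Rightarrow> ereal" where
  "pointwise_dim M x = Lim (at_right 0) (pointwise_quotient M x)"

definition markov_quotient :: "real measure \<Rightarrow> real \<Rightarrow> nat \<Rightarrow> ereal" where
  "markov_quotient M x n = ext_ln (measure M (cylinder n x)) / ereal (ln (cylinder_length n x))"

definition markov_dim_exists :: "real measure \<Rightarrow> real \<Rightarrow> bool" where
  "markov_dim_exists M x \<longleftrightarrow> convergent (markov_quotient M x)"

definition markov_dim :: "real measure \<Rightarrow> real \<Rightarrow> ereal" where
  "markov_dim M x = lim (markov_quotient M x)"

definition lyapunov_exists :: "real \<Rightarrow> bool" where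
  "lyapunov_exists x \<longleftrightarrow> convergent (\<lambda>n. 1 / real n * ln \<bar>deriv (gauss_map ^^ n) x\<bar>)"

definition comparable :: "(nat \<Rightarrow> real) \<Rightarrow> (nat \<Rightarrow> real) \<Rightarrow> bool" where
  "comparable u v \<longleftrightarrow>
     (\<exists>c1>0. \<exists>c2>0. \<forall>\<^sub>F n in sequentially. c1 * v n \<le> u n \<and> u n \<le> c2 * v n)"

end

theory Submission
  imports Defs
begin

text \<open>
  Let \<open>P\<^sub>n(x)\<close> be the product of \<open>T\<^sup>j x\<close> over \<open>j < n\<close>, so that \<open>|(T\<^sup>n)'(x)| = P\<^sub>n(x)\<^sup>-\<^sup>2\<close>. Two points
  of the same cylinder of order \<open>n\<close> satisfy \<open>|y - z| = |T\<^sup>n y - T\<^sup>n z| P\<^sub>n(y) P\<^sub>n(z)\<close>, and \<open>P\<^sub>n\<close> varies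
  at most by a factor 2 on a cylinder. Hence \<open>I\<^sub>n(x)\<close> is contained in a ball around \<open>x\<close> of radius
  \<open>2 P\<^sub>n(x)\<^sup>2\<close>. Conversely it contains the ball of radius \<open>P\<^sub>n\<^sub>+\<^sub>2(x)\<^sup>2 / 4\<close>, since an irrational point
  \<open>u\<close> keeps a distance of order \<open>u\<^sup>2 T(u) T\<^sup>2(u)\<close> from the end points of its cylinder of order 1.
  If the Lyapunov exponent exists, it is positive, and then
  \<open>- log P\<^sub>n(x)\<^sup>2\<close> and \<open>- log P\<^sub>n\<^sub>+\<^sub>k(x)\<^sup>2\<close> are asymptotically equal for fixed \<open>k\<close>; a ball of radius
  \<open>r\<close> is squeezed between two cylinders of orders differing by 7 whose log-lengths are asymptotic to
  \<open>log r\<close>. In the first part the balls of radius \<open>|I\<^sub>n(x)|\<close> are simply a sequence of radii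
  tending to 0.
\<close>

section \<open>Products along Gauss orbits and irrationality of the orbit\<close>

definition orbit_prod :: "nat \<Rightarrow> real \<Rightarrow> real" where
  "orbit_prod n x = (\<Prod>j<n. (gauss_map ^^ j) x)"

lemma orbit_prod_0 [simp]: "orbit_prod 0 x = 1"
  by (simp add: orbit_prod_def)

lemma orbit_prod_Suc: "orbit_prod (Suc n) x = orbit_prod n x * (gauss_map ^^ n) x"
  by (simp add: orbit_prod_def)

lemma gauss_map_nonneg: "0 \<le> gauss_map x" and gauss_map_lt_1: "gauss_map x < 1"
  by (simp_all add: gauss_map_def frac_lt_1)

lemma funpow_gauss_map_bounds:
  assumes "x \<in> {0..<1}"
  shows "(gauss_map ^^ n) x \<in> {0..<1}"
  using assms by (cases n) (auto simp: gauss_map_nonneg gauss_map_lt_1)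

lemma gauss_map_eq: "gauss_map x = 1 / x - of_int \<lfloor>1 / x\<rfloor>"
  by (simp add: gauss_map_def frac_def)

lemma Rats_inverse_iff: "1 / x \<in> \<rat> \<longleftrightarrow> x \<in> \<rat>" for x :: real
proof
  assume "1 / x \<in> \<rat>"
  then have "inverse (1 / x) \<in> \<rat>" by (rule Rats_inverse)
  then show "x \<in> \<rat>" by (simp only: inverse_eq_divide divide_divide_eq_right div_by_1 mult_1)
qed (simp add: Rats_inverse divide_inverse)

lemma gauss_map_irrational:
  assumes "x \<notin> \<rat>"
  shows "gauss_map x \<notin> \<rat>"
proof
  assume "gauss_map x \<in> \<rat>"
  then have "gauss_map x + of_int \<lfloor>1 / x\<rfloor> \<in> \<rat>" by simp
  then have "1 / x \<in> \<rat>" by (simp add: gauss_map_eq)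
  with assms show False by (simp add: Rats_inverse_iff)
qed

lemma funpow_gauss_map_irrational:
  "x \<notin> \<rat> \<Longrightarrow> (gauss_map ^^ n) x \<notin> \<rat>"
  by (induction n) (auto simp: gauss_map_irrational)

lemma funpow_gauss_map_pos:
  assumes "x \<in> {0..<1}" "x \<notin> \<rat>"
  shows "0 < (gauss_map ^^ n) x"
  using funpow_gauss_map_bounds[OF assms(1), of n] funpow_gauss_map_irrational[OF assms(2), of n]
  by (metis Rats_0 atLeastLessThan_iff order_le_less)

section \<open>Estimates for a single step of the Gauss map\<close>

lemma floor_inverse_ge_1:
  fixes u :: real
  assumes "0 < u" "u < 1"
  shows "1 \<le> \<lfloor>1 / u\<rfloor>"
  using assms by (simp add: le_floor_iff)

text \<open>With \<open>a\<close> the first partial quotient of \<open>u\<close>, the number 1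
  splits into \<open>u * a\<close> and \<open>u * gauss_map u\<close>; the second summand is the
  smaller one because \<open>gauss_map u < 1 <= a\<close>.\<close>

lemma gauss_map_mult_le_half:
  assumes "0 < u" "u < 1"
  shows "u * gauss_map u \<le> 1 / 2"
proof -
  have 1: "(1::real) \<le> of_int \<lfloor>1 / u\<rfloor>" using floor_inverse_ge_1[OF assms] by simp
  have 2: "u * (of_int \<lfloor>1 / u\<rfloor> + gauss_map u) = 1" using assms by (simp add: gauss_map_eq)
  have "u * gauss_map u \<le> u * of_int \<lfloor>1 / u\<rfloor>"
    using 1 gauss_map_lt_1[of u] assms by (intro mult_left_mono) linarith+
  with 2 show ?thesis by (simp add: algebra_simps)
qed

lemma gauss_map_mult_le:
  assumes "0 < u" "u < 1"
  shows "u * gauss_map u \<le> 1 - u"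
proof -
  have 1: "(1::real) \<le> of_int \<lfloor>1 / u\<rfloor>" using floor_inverse_ge_1[OF assms] by simp
  have 2: "u * (of_int \<lfloor>1 / u\<rfloor> + gauss_map u) = 1" using assms by (simp add: gauss_map_eq)
  have "u * 1 \<le> u * of_int \<lfloor>1 / u\<rfloor>"
    using 1 assms by (intro mult_left_mono) linarith+
  with 2 show ?thesis by (simp add: algebra_simps)
qed

text \<open>Write \<open>u = 1 / (a + s)\<close>, a point between \<open>1 / (a + 1)\<close> and
  \<open>1 / a\<close>. Its distances to these end points are \<open>u * (1 - s) / (a + 1)\<close>
  and \<open>u * s / a\<close>. Since \<open>1 - s\<close> is at least \<open>s * t\<close>, both
  dominate the radius, so \<open>v\<close> cannot leave the interval.\<close>

lemma floor_inverse_eq_nearby: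
  assumes u: "0 < u" "u < 1" and s: "0 < gauss_map u"
    and v: "\<bar>v - u\<bar> < u\<^sup>2 * (gauss_map u * gauss_map (gauss_map u)) / 2"
  shows "\<lfloor>1 / v\<rfloor> = \<lfloor>1 / u\<rfloor>"
proof -
  define a :: real where "a = of_int \<lfloor>1 / u\<rfloor>"
  define s t where "s = gauss_map u" and "t = gauss_map s"
  have a1: "1 \<le> a" unfolding a_def using floor_inverse_ge_1[OF u] by simp
  have s01: "0 < s" "s < 1" using s gauss_map_lt_1 by (simp_all add: s_def)
  have t01: "0 \<le> t" "t < 1" by (simp_all add: t_def gauss_map_nonneg gauss_map_lt_1)
  have st: "s * t \<le> 1 - s" unfolding t_def by (rule gauss_map_mult_le[OF s01])
  have ua: "u * (a + s) = 1" using u by (simp add: a_def s_def gauss_map_eq)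
  have u_eq: "u = 1 / (a + s)" using ua a1 s01 by (simp add: field_simps)
  have v': "\<bar>v - u\<bar> < u\<^sup>2 * (s * t) / 2" using v by (simp add: s_def t_def)
  \<comment> \<open>As \<open>1 <= a\<close>, \<open>a + 1\<close> is at most
    \<open>2 * (a + s)\<close>; this is the source of the factor 1/2 in the radius.\<close>
  have half: "u / 2 \<le> 1 / (a + 1)" unfolding u_eq using a1 s01 by (simp add: field_simps)
  have low: "1 / (a + 1) < v"
  proof -
    have "u - 1 / (a + 1) = (1 - s) * u * (1 / (a + 1))"
      unfolding u_eq using a1 s01 by (simp add: field_simps)
    also have "\<dots> \<ge> (s * t) * u * (u / 2)"
      using st half u s01 t01 by (intro mult_mono) auto
    finally have "u\<^sup>2 * (s * t) / 2 \<le> u - 1 / (a + 1)"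
      by (simp add: power2_eq_square mult_ac)
    with v' show ?thesis by linarith
  qed
  have up: "v < 1 / a"
  proof -
    have "u \<le> 1 / a" unfolding u_eq using a1 s01 by (simp add: frac_le)
    moreover have "1 / a - u = s * u * (1 / a)"
      unfolding u_eq using a1 s01 by (simp add: field_simps)
    ultimately have "1 / a - u \<ge> s * u * u"
      using mult_left_mono[of u "1 / a" "s * u"] u s01 by simp
    moreover have "s * u * u * t \<le> s * u * u * 1"
      using s01 t01 u by (intro mult_left_mono) auto
    moreover have "0 \<le> s * u * u * t" using s01 t01 u by simp
    moreover have "u\<^sup>2 * (s * t) / 2 = s * u * u * t / 2" by (simp add: power2_eq_square mult_ac)
    ultimately show ?thesis using v' by linarith
  qed
  have vpos: "0 < v" using low a1 by (smt (verit) divide_pos_pos)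
  have "a < 1 / v" "1 / v < a + 1" using low up vpos a1 by (simp_all add: field_simps)
  then show ?thesis unfolding a_def by linarith
qed

section \<open>Cylinders, measurability, and the derivative of the Gauss map\<close>

lemma cylinder_0 [simp]: "cylinder 0 x = {0..<1}"
  by (auto simp: cylinder_def)

lemma cylinder_Suc:
  "cylinder (Suc n) x =
     {y \<in> cylinder n x. \<lfloor>1 / (gauss_map ^^ n) y\<rfloor> = \<lfloor>1 / (gauss_map ^^ n) x\<rfloor>}"
  by (auto simp: cylinder_def partial_quotient_def atLeastAtMostSuc_conv)

lemma cylinder_subset_unit: "cylinder n x \<subseteq> {0..<1}"
  by (auto simp: cylinder_def)

lemma self_in_cylinder: "x \<in> {0..<1} \<Longrightarrow> x \<in> cylinder n x"
  by (simp add: cylinder_def)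

lemma borel_measurable_gauss_map [measurable]: "gauss_map \<in> borel_measurable borel"
  unfolding gauss_map_def[abs_def] frac_def by measurable

lemma borel_measurable_funpow_gauss_map [measurable]:
  "(gauss_map ^^ n) \<in> borel_measurable borel"
proof (induction n)
  case (Suc n)
  from measurable_comp[OF this borel_measurable_gauss_map] show ?case by simp
qed (simp add: id_def)

lemma cylinder_borel [measurable]: "cylinder n x \<in> sets borel"
proof (induction n)
  case (Suc n)
  have "cylinder (Suc n) x =
    cylinder n x \<inter> {y \<in> space borel. \<lfloor>1 / (gauss_map ^^ n) y\<rfloor> = \<lfloor>1 / (gauss_map ^^ n) x\<rfloor>}"
    by (auto simp: cylinder_Suc)
  also have "\<dots> \<in> sets borel" using Suc.IH by measurable
  finally show ?case .
qed simp

lemma fmeasurable_lborel_Icc: "{a..b} \<in> fmeasurable lborel" for a b :: real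
  by (intro fmeasurableI) (simp_all add: emeasure_lborel_Icc_eq)

text \<open>For irrational \<open>u\<close> the value \<open>1 / u\<close> is not an integer, so the
  floor is constant near \<open>u\<close> and the Gauss map is locally \<open>1 / v\<close> minus a
  constant.\<close>

lemma gauss_map_has_derivative:
  assumes "u \<notin> \<rat>"
  shows "(gauss_map has_real_derivative - (1 / u\<^sup>2)) (at u)"
proof -
  have u0: "u \<noteq> 0" using assms by auto
  have "1 / u \<notin> \<int>" using assms Ints_subset_Rats Rats_inverse_iff by blast
  then have lo: "of_int \<lfloor>1 / u\<rfloor> < 1 / u"
    by (metis Ints_of_int of_int_floor_le order_le_less)
  have lim: "((\<lambda>v. 1 / v) \<longlongrightarrow> 1 / u) (nhds u)"
    using u0 by (intro tendsto_divide tendsto_const filterlim_ident)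
  have "1 / u < of_int \<lfloor>1 / u\<rfloor> + 1" by linarith
  then have "\<forall>\<^sub>F v in nhds u. of_int \<lfloor>1 / u\<rfloor> < 1 / v \<and> 1 / v < of_int \<lfloor>1 / u\<rfloor> + 1"
    using order_tendstoD[OF lim] lo by (intro eventually_conj) auto
  then have ev: "\<forall>\<^sub>F v in nhds u. gauss_map v = 1 / v - of_int \<lfloor>1 / u\<rfloor>"
  proof eventually_elim
    case (elim v)
    then have "\<lfloor>1 / v\<rfloor> = \<lfloor>1 / u\<rfloor>" by linarith
    then show ?case by (simp add: gauss_map_eq)
  qed
  have "((\<lambda>v. 1 / v - of_int \<lfloor>1 / u\<rfloor>) has_real_derivative - (1 / u\<^sup>2)) (at u)"
    using u0 by (auto intro!: derivative_eq_intros simp: power2_eq_square)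
  then show ?thesis using DERIV_cong_ev[OF refl ev refl] by blast
qed

lemma eventually_at_right_0_less: "0 < c \<Longrightarrow> \<forall>\<^sub>F r in at_right (0::real). 0 < r \<and> r < c"
  by (auto simp: eventually_at_right_field)

section \<open>Decay of the orbit products of a fixed irrational point\<close>

context
  fixes x :: real
  assumes x: "x \<in> {0..<1}" "x \<notin> \<rat>"
begin

lemma orbit_pos: "0 < (gauss_map ^^ n) x" and orbit_less_1: "(gauss_map ^^ n) x < 1"
  using funpow_gauss_map_pos[OF x] funpow_gauss_map_bounds[OF x(1)] by auto

lemma orbit_prod_pos: "0 < orbit_prod n x"
  by (induction n) (simp_all add: orbit_pos orbit_prod_Suc)

lemma orbit_prod_Suc_le: "orbit_prod (Suc n) x \<le> orbit_prod n x"
  using orbit_prod_pos[of n] orbit_less_1[of n] by (simp add: mult_left_le orbit_prod_Suc)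

lemma orbit_prod_antimono: "m \<le> n \<Longrightarrow> orbit_prod n x \<le> orbit_prod m x"
  by (rule lift_Suc_antimono_le) (rule orbit_prod_Suc_le)

text \<open>A single factor can be close to 1, but two consecutive factors always multiply to at
  most 1/2. This gives exponential decay at a rate independent of \<open>x\<close>.\<close>

lemma orbit_prod_halves: "orbit_prod (n + 2) x \<le> orbit_prod n x / 2"
proof -
  have "(gauss_map ^^ n) x * (gauss_map ^^ Suc n) x \<le> 1 / 2"
    using gauss_map_mult_le_half[OF orbit_pos[of n] orbit_less_1[of n]] by simp
  from mult_left_mono[OF this less_imp_le[OF orbit_prod_pos[of n]]]
  show ?thesis by (simp add: mult.assoc orbit_prod_Suc)
qed

lemma orbit_prod_even_le: "orbit_prod (2 * n) x \<le> (1 / 2) ^ n"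
proof (induction n)
  case (Suc n)
  then show ?case using orbit_prod_halves[of "2 * n"] by simp
qed simp

lemma orbit_prod_tendsto_0: "(\<lambda>n. orbit_prod n x) \<longlonglongrightarrow> 0"
proof -
  have "(\<lambda>n. (1 / 2 :: real) ^ n) \<longlonglongrightarrow> 0" by (simp add: LIMSEQ_realpow_zero)
  moreover have "filterlim (\<lambda>n::nat. n div 2) at_top at_top"
    by (rule filterlim_at_top_div_const_nat) simp
  ultimately have lim: "(\<lambda>n. (1 / 2 :: real) ^ (n div 2)) \<longlonglongrightarrow> 0"
    by (rule filterlim_compose)
  have "orbit_prod n x \<le> (1 / 2) ^ (n div 2)" for n
    using orbit_prod_antimono[of "2 * (n div 2)" n] orbit_prod_even_le[of "n div 2"] by simp
  then show ?thesis
    by (intro tendsto_sandwich[OF _ _ tendsto_const lim])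
      (auto intro: always_eventually less_imp_le orbit_prod_pos)
qed

section \<open>Distortion of orbit products on a cylinder\<close>

lemma cylinder_orbit_pos:
  assumes "y \<in> cylinder n x" "j < n"
  shows "0 < (gauss_map ^^ j) y"
proof -
  have "y \<in> {0..<1}" using assms cylinder_subset_unit by blast
  then have nonneg: "0 \<le> (gauss_map ^^ j) y" using funpow_gauss_map_bounds by fastforce
  \<comment> \<open>The point \<open>y\<close> may be rational. If its orbit reached 0 at time
    \<open>j\<close>, the convention \<open>1 / 0 = 0\<close> would give the partial quotient 0,
    whereas that of \<open>x\<close> is at least 1.\<close>
  have "partial_quotient (Suc j) y = partial_quotient (Suc j) x"
    using assms by (auto simp: cylinder_def)
  then have "1 \<le> \<lfloor>1 / (gauss_map ^^ j) y\<rfloor>"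
    using floor_inverse_ge_1[OF orbit_pos[of j] orbit_less_1[of j]]
    by (simp add: partial_quotient_def)
  then have "(gauss_map ^^ j) y \<noteq> 0" by auto
  with nonneg show ?thesis by simp
qed

lemma cylinder_orbit_prod_pos: "y \<in> cylinder n x \<Longrightarrow> 0 < orbit_prod n y"
  unfolding orbit_prod_def by (intro prod_pos) (simp add: cylinder_orbit_pos)

text \<open>\<open>A\<close> and \<open>B\<close> are the continuants \<open>q\<^sub>n\<close> and \<open>q\<^sub>n\<^sub>-\<^sub>1\<close>.\<close>

lemma inverse_orbit_prod_affine:
  "\<exists>A B. 0 \<le> B \<and> B \<le> A \<and> 0 < A \<and>
     (\<forall>y\<in>cylinder n x. 1 / orbit_prod n y = A + B * (gauss_map ^^ n) y)"
proof (induction n)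
  case 0
  show ?case by (rule exI[of _ 1], rule exI[of _ 0]) simp
next
  case (Suc n)
  then obtain A B where AB: "0 \<le> B" "B \<le> A" "0 < A"
    and eq: "\<And>y. y \<in> cylinder n x \<Longrightarrow> 1 / orbit_prod n y = A + B * (gauss_map ^^ n) y"
    by blast
  define a :: real where "a = of_int \<lfloor>1 / (gauss_map ^^ n) x\<rfloor>"
  have a1: "1 \<le> a"
    using floor_inverse_ge_1[OF orbit_pos[of n] orbit_less_1[of n]] by (simp add: a_def)
  \<comment> \<open>The continuant recurrence: with \<open>1 / t = a + gauss_map t\<close>, dividing
    \<open>A + B * t\<close> by \<open>t\<close> turns the pair \<open>(A, B)\<close> into
    \<open>(a * A + B, A)\<close>.\<close>
  have "1 / orbit_prod (Suc n) y = (a * A + B) + A * (gauss_map ^^ Suc n) y"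
    if y: "y \<in> cylinder (Suc n) x" for y
  proof -
    define t where "t = (gauss_map ^^ n) y"
    have t: "0 < t" using cylinder_orbit_pos[OF y, of n] by (simp add: t_def)
    have "gauss_map t = 1 / t - a"
      using y by (simp add: gauss_map_eq a_def t_def cylinder_Suc)
    then have g: "(gauss_map ^^ Suc n) y = 1 / t - a" by (simp add: t_def)
    have "1 / orbit_prod (Suc n) y = (1 / orbit_prod n y) / t"
      by (simp add: t_def orbit_prod_Suc)
    also have "1 / orbit_prod n y = A + B * t"
      using y eq[of y] by (simp add: t_def cylinder_Suc)
    finally show ?thesis using t unfolding g by (simp add: field_simps)
  qed
  moreover have "1 * A \<le> a * A" using a1 AB by (intro mult_right_mono) auto
  then have "A \<le> a * A + B" "0 < a * A + B" using AB by linarith+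
  ultimately show ?case
    using AB by (intro exI[of _ A] exI[of "\<lambda>A. \<exists>B. _ A B" "a * A + B"]) simp
qed

text \<open>The inverse products have the form \<open>A + B * w\<close> with \<open>w\<close> in the
  unit interval and \<open>0 <= B <= A\<close>, so all of them lie between \<open>A\<close> and
  \<open>2 * A\<close>, with the same \<open>A\<close> for the whole cylinder.\<close>

lemma orbit_prod_distortion:
  assumes y: "y \<in> cylinder n x" and z: "z \<in> cylinder n x"
  shows "orbit_prod n y \<le> 2 * orbit_prod n z"
proof -
  obtain A B where AB: "0 \<le> B" "B \<le> A" "0 < A"
    and eq: "\<And>y. y \<in> cylinder n x \<Longrightarrow> 1 / orbit_prod n y = A + B * (gauss_map ^^ n) y"
    using inverse_orbit_prod_affine by blast
  have bounds: "(gauss_map ^^ n) y \<in> {0..<1}" "(gauss_map ^^ n) z \<in> {0..<1}"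
    using y z cylinder_subset_unit by (blast intro: funpow_gauss_map_bounds)+
  have "B * (gauss_map ^^ n) z \<le> A * 1" using bounds AB by (intro mult_mono) auto
  moreover have "0 \<le> B * (gauss_map ^^ n) y" using bounds AB by simp
  ultimately have "1 / orbit_prod n z \<le> 2 * (1 / orbit_prod n y)"
    unfolding eq[OF y] eq[OF z] using AB by (simp add: algebra_simps)
  then show ?thesis
    using cylinder_orbit_prod_pos[OF y] cylinder_orbit_prod_pos[OF z] by (simp add: field_simps)
qed

text \<open>Equal partial quotients cancel in the difference of two images, leaving
  \<open>|1/t - 1/u| = |t - u| / (t * u)\<close>. Iterating this makes the factors telescope into
  the two orbit products.\<close>

lemma cylinder_dist_eq:
  assumes "y \<in> cylinder n x" "z \<in> cylinder n x"
  shows "\<bar>y - z\<bar> = \<bar>(gauss_map ^^ n) y - (gauss_map ^^ n) z\<bar> * (orbit_prod n y * orbit_prod n z)"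
  using assms
proof (induction n)
  case (Suc n)
  define t u where "t = (gauss_map ^^ n) y" and "u = (gauss_map ^^ n) z"
  have tu: "0 < t" "0 < u"
    using cylinder_orbit_pos[OF Suc.prems(1), of n] cylinder_orbit_pos[OF Suc.prems(2), of n]
    by (simp_all add: t_def u_def)
  have "\<lfloor>1 / t\<rfloor> = \<lfloor>1 / u\<rfloor>" using Suc.prems by (simp add: t_def u_def cylinder_Suc)
  then have "gauss_map t - gauss_map u = (u - t) / (t * u)"
    using tu by (simp add: gauss_map_eq field_simps)
  then have "\<bar>gauss_map t - gauss_map u\<bar> * (t * u) = \<bar>t - u\<bar>"
    using tu by (simp add: abs_mult abs_minus_commute)
  moreover have "\<bar>y - z\<bar> = \<bar>t - u\<bar> * (orbit_prod n y * orbit_prod n z)"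
    using Suc by (simp add: t_def u_def cylinder_Suc)
  ultimately show ?case by (simp add: t_def u_def mult_ac orbit_prod_Suc)
qed simp

section \<open>Cylinders between balls, and bounds for their lengths\<close>

lemma cylinder_subset_cball: "cylinder n x \<subseteq> cball x (2 * (orbit_prod n x)\<^sup>2)"
proof
  fix y assume y: "y \<in> cylinder n x"
  have xc: "x \<in> cylinder n x" by (rule self_in_cylinder[OF x(1)])
  have "(gauss_map ^^ n) y \<in> {0..<1}"
    using y cylinder_subset_unit by (blast intro: funpow_gauss_map_bounds)
  then have "\<bar>(gauss_map ^^ n) x - (gauss_map ^^ n) y\<bar> \<le> 1"
    using orbit_pos[of n] orbit_less_1[of n] by (auto simp: abs_le_iff)
  moreover have "orbit_prod n x * orbit_prod n y \<le> orbit_prod n x * (2 * orbit_prod n x)"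
    using orbit_prod_distortion[OF y xc] orbit_prod_pos[of n] by (intro mult_left_mono) auto
  ultimately have "\<bar>x - y\<bar> \<le> 1 * (orbit_prod n x * (2 * orbit_prod n x))"
    unfolding cylinder_dist_eq[OF xc y]
    using orbit_prod_pos[of n] cylinder_orbit_prod_pos[OF y] by (intro mult_mono) auto
  then show "y \<in> cball x (2 * (orbit_prod n x)\<^sup>2)"
    by (simp add: dist_real_def power2_eq_square)
qed

text \<open>In the induction step the smaller ball already lies in the cylinder of order
  \<open>n\<close>. The distance identity carries it to a neighbourhood of the \<open>n\<close>-th
  iterate, where \<open>floor_inverse_eq_nearby\<close> fixes one more partial quotient. The factor
  1/4 is 1/2 from the distortion times 1/2 from that lemma.\<close>

lemma ball_subset_cylinder: "ball x ((orbit_prod (n + 2) x)\<^sup>2 / 4) \<subseteq> cylinder n x"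
proof (induction n)
  case 0
  define s where "s = gauss_map x"
  have x01: "0 < x" "x < 1" using orbit_pos[of 0] orbit_less_1[of 0] by simp_all
  have s01: "0 < s" "s < 1" using orbit_pos[of 1] orbit_less_1[of 1] by (simp_all add: s_def)
  have xs: "x * s \<le> 1 - x" "x * s \<le> x"
    using gauss_map_mult_le[OF x01] s01 x01 by (simp_all add: s_def)
  \<comment> \<open>For order 0 only the end points 0 and 1 must be avoided: \<open>x * s\<close> is
    at most \<open>x\<close> and at most \<open>1 - x\<close>, and squaring makes it no
    larger.\<close>
  have "(x * s)\<^sup>2 \<le> x * s"
    using x01 s01 by (simp add: power2_eq_square mult_left_le mult_le_one)
  moreover have "orbit_prod (0 + 2) x = x * s" by (simp add: s_def numeral_2_eq_2 orbit_prod_Suc)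
  moreover have "0 < x * s" using x01 s01 by simp
  ultimately have "(orbit_prod (0 + 2) x)\<^sup>2 / 4 \<le> x" "(orbit_prod (0 + 2) x)\<^sup>2 / 4 \<le> 1 - x"
    using xs by simp_all
  moreover have "\<bar>x - y\<bar> < c \<Longrightarrow> c \<le> x \<Longrightarrow> c \<le> 1 - x \<Longrightarrow> y \<in> {0..<1}" for y c
    unfolding atLeastLessThan_iff by linarith
  ultimately show ?case unfolding cylinder_0 by (auto simp only: dist_real_def mem_ball)
next
  case (Suc n)
  define u s t where "u = (gauss_map ^^ n) x" and "s = gauss_map u" and "t = gauss_map s"
  have u01: "0 < u" "u < 1" using orbit_pos[of n] orbit_less_1[of n] by (simp_all add: u_def)
  have s01: "0 < s" "s < 1"
    using orbit_pos[of "Suc n"] orbit_less_1[of "Suc n"] by (simp_all add: u_def s_def)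
  have t01: "0 < t" "t < 1"
    using orbit_pos[of "Suc (Suc n)"] orbit_less_1[of "Suc (Suc n)"]
    by (simp_all add: u_def s_def t_def)
  define p where "p = orbit_prod n x"
  have p: "0 < p" unfolding p_def by (rule orbit_prod_pos)
  have P3: "orbit_prod (Suc n + 2) x = p * u * (s * t)"
    by (simp add: p_def u_def s_def t_def orbit_prod_Suc)
  show ?case
  proof
    fix y assume y: "y \<in> ball x ((orbit_prod (Suc n + 2) x)\<^sup>2 / 4)"
    have "(orbit_prod (Suc n + 2) x)\<^sup>2 \<le> (orbit_prod (n + 2) x)\<^sup>2"
      using orbit_prod_Suc_le[of "n + 2"] orbit_prod_pos[of "Suc n + 2"]
      by (intro power_mono) auto
    then have yn: "y \<in> cylinder n x" using y Suc.IH by (auto simp: subset_iff)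
    have xn: "x \<in> cylinder n x" by (rule self_in_cylinder[OF x(1)])
    define v where "v = (gauss_map ^^ n) y"
    have "\<bar>v - u\<bar> * (p * p / 2) \<le> \<bar>v - u\<bar> * (orbit_prod n y * orbit_prod n x)"
      using orbit_prod_distortion[OF xn yn] p by (intro mult_left_mono) (auto simp: p_def)
    also have "\<dots> = \<bar>y - x\<bar>"
      using cylinder_dist_eq[OF yn xn] by (simp add: u_def v_def)
    also have "\<dots> < (p * u * (s * t))\<^sup>2 / 4"
      using y unfolding P3 by (simp add: dist_real_def abs_minus_commute)
    also have "\<dots> = (u\<^sup>2 * (s * t) / 2) * (s * t) * (p * p / 2)"
      by (simp add: power2_eq_square)
    \<comment> \<open>One surplus factor \<open>s * t <= 1\<close> from the squared orbit product is
      discarded.\<close>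
    also have "\<dots> \<le> (u\<^sup>2 * (s * t) / 2) * 1 * (p * p / 2)"
      using s01 t01 by (intro mult_right_mono mult_left_mono mult_le_one) auto
    finally have "\<bar>v - u\<bar> < u\<^sup>2 * (s * t) / 2" using p by simp
    then have "\<lfloor>1 / v\<rfloor> = \<lfloor>1 / u\<rfloor>"
      using floor_inverse_eq_nearby[OF u01] s01 by (simp add: s_def t_def)
    then show "y \<in> cylinder (Suc n) x" using yn by (simp add: cylinder_Suc u_def v_def)
  qed
qed

lemma cylinder_length_le: "cylinder_length n x \<le> 4 * (orbit_prod n x)\<^sup>2"
proof -
  let ?r = "2 * (orbit_prod n x)\<^sup>2"
  have "cylinder_length n x \<le> measure lborel {x - ?r..x + ?r}"
    unfolding cylinder_length_def using cylinder_subset_cball[of n]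
    by (intro measure_mono_fmeasurable fmeasurable_lborel_Icc) (simp_all add: cball_eq_atLeastAtMost)
  then show ?thesis by simp
qed

lemma cylinder_length_ge: "(orbit_prod (n + 2) x)\<^sup>2 / 2 \<le> cylinder_length n x"
proof -
  let ?r = "(orbit_prod (n + 2) x)\<^sup>2 / 4"
  have fin: "cylinder n x \<in> fmeasurable lborel"
    by (rule fmeasurableI2[OF fmeasurable_lborel_Icc[of 0 1]])
      (use cylinder_subset_unit[of n x] in fastforce)+
  have "measure lborel {x - ?r<..<x + ?r} \<le> cylinder_length n x"
    unfolding cylinder_length_def using ball_subset_cylinder[of n]
    by (intro measure_mono_fmeasurable[OF _ _ fin]) (simp_all add: ball_eq_greaterThanLessThan)
  then show ?thesis by simp
qed

lemma cylinder_length_pos: "0 < cylinder_length n x"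
  using cylinder_length_ge[of n] orbit_prod_pos[of "n + 2"]
  by (smt (verit) half_gt_zero zero_less_power)

lemma cylinder_length_tendsto_0: "(\<lambda>n. cylinder_length n x) \<longlonglongrightarrow> 0"
proof -
  have lim: "(\<lambda>n. 4 * (orbit_prod n x)\<^sup>2) \<longlonglongrightarrow> 0"
    by (rule tendsto_eq_intros orbit_prod_tendsto_0 refl)+ simp
  show ?thesis
    by (rule tendsto_sandwich[OF _ _ tendsto_const lim])
      (simp_all add: cylinder_length_le less_imp_le[OF cylinder_length_pos])
qed

section \<open>The derivative of the iterates and the Lyapunov exponent\<close>

lemma abs_deriv_funpow_gauss_map: "\<bar>deriv (gauss_map ^^ n) x\<bar> = 1 / (orbit_prod n x)\<^sup>2"
proof -
  \<comment> \<open>The induction carries differentiability along, since the chain rule needs it and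
    \<open>deriv\<close> alone does not supply it.\<close>
  have "\<exists>D. ((gauss_map ^^ n) has_real_derivative D) (at x) \<and> \<bar>D\<bar> = 1 / (orbit_prod n x)\<^sup>2"
  proof (induction n)
    case 0
    show ?case by (intro exI[of _ 1]) (simp add: id_def)
  next
    case (Suc n)
    then obtain D where D: "((gauss_map ^^ n) has_real_derivative D) (at x)"
      "\<bar>D\<bar> = 1 / (orbit_prod n x)\<^sup>2" by blast
    have "(gauss_map has_real_derivative - (1 / ((gauss_map ^^ n) x)\<^sup>2)) (at ((gauss_map ^^ n) x))"
      by (intro gauss_map_has_derivative funpow_gauss_map_irrational x)
    from DERIV_chain[OF this D(1)]
    have "((gauss_map ^^ Suc n) has_real_derivative - (1 / ((gauss_map ^^ n) x)\<^sup>2) * D) (at x)"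
      by simp
    moreover have "\<bar>- (1 / ((gauss_map ^^ n) x)\<^sup>2) * D\<bar> = 1 / (orbit_prod (Suc n) x)\<^sup>2"
      using D(2) by (simp add: orbit_prod_Suc abs_mult power_mult_distrib mult.commute)
    ultimately show ?case by blast
  qed
  then show ?thesis using DERIV_imp_deriv by blast
qed

text \<open>This is \<open>ln |(T^n)'(x)|\<close>, expressed without \<open>deriv\<close>.\<close>

definition log_expansion :: "nat \<Rightarrow> real" where
  "log_expansion n = - 2 * ln (orbit_prod n x)"

lemma ln_orbit_prod_square_divide:
  "c > 0 \<Longrightarrow> ln ((orbit_prod n x)\<^sup>2 / c) = - (log_expansion n + ln c)"
  using orbit_prod_pos[of n] by (simp add: log_expansion_def ln_div ln_realpow)

lemma log_expansion_even_ge: "real (2 * n) * ln 2 \<le> log_expansion (2 * n)"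
proof -
  have "ln (orbit_prod (2 * n) x) \<le> ln ((1 / 2) ^ n)"
    using orbit_prod_even_le[of n] orbit_prod_pos[of "2 * n"] by simp
  also have "\<dots> = - (real n * ln 2)" by (simp add: ln_realpow ln_div)
  finally show ?thesis by (simp add: log_expansion_def)
qed

text \<open>Positivity comes from the halving of orbit products over two steps. It is what later
  makes quotients of two sequences with the same linear growth rate tend to 1.\<close>

lemma lyapunov_expansion:
  assumes "lyapunov_exists x"
  obtains l where "0 < l" "(\<lambda>n. log_expansion n / real n) \<longlonglongrightarrow> l"
proof -
  have "1 / real n * ln \<bar>deriv (gauss_map ^^ n) x\<bar> = log_expansion n / real n" for n
    using orbit_prod_pos[of n]
    by (simp add: abs_deriv_funpow_gauss_map log_expansion_def ln_div ln_realpow)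
  with assms have "convergent (\<lambda>n. log_expansion n / real n)"
    unfolding lyapunov_exists_def by (simp only:)
  then obtain l where l: "(\<lambda>n. log_expansion n / real n) \<longlonglongrightarrow> l"
    unfolding convergent_def by blast
  \<comment> \<open>Since the limit exists, it may be bounded below along the even indices, where
    the growth is at least \<open>ln 2\<close> per step.\<close>
  have "strict_mono (\<lambda>n::nat. 2 * n)" by (simp add: strict_mono_def)
  from LIMSEQ_subseq_LIMSEQ[OF l this]
  have "(\<lambda>n. log_expansion (2 * n) / real (2 * n)) \<longlonglongrightarrow> l" by (simp add: o_def)
  then have "ln 2 \<le> l"
  proof (rule tendsto_lowerbound)
    show "\<forall>\<^sub>F n in sequentially. ln 2 \<le> log_expansion (2 * n) / real (2 * n)"
      using eventually_gt_at_top[of 0]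
    proof eventually_elim
      case (elim n)
      then show ?case using log_expansion_even_ge[of n] by (simp add: field_simps)
    qed
  qed simp
  then have "0 < l" by (smt (verit) ln_gt_zero)
  with l show thesis by (rule that[rotated])
qed

lemma log_cylinder_length_bounds:
  "log_expansion n - ln 4 \<le> - ln (cylinder_length n x)"
  "- ln (cylinder_length n x) \<le> log_expansion (n + 2) + ln 2"
proof -
  have "ln (cylinder_length n x) \<le> ln (4 * (orbit_prod n x)\<^sup>2)"
    using cylinder_length_le[of n] cylinder_length_pos[of n] by (subst ln_le_cancel_iff) auto
  also have "\<dots> = ln 4 - log_expansion n"
    using orbit_prod_pos[of n] by (simp add: log_expansion_def ln_mult ln_realpow)
  finally show "log_expansion n - ln 4 \<le> - ln (cylinder_length n x)" by simp
  have "ln ((orbit_prod (n + 2) x)\<^sup>2 / 2) \<le> ln (cylinder_length n x)"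
    using cylinder_length_ge[of n] cylinder_length_pos[of n] orbit_prod_pos[of "n + 2"]
    by (subst ln_le_cancel_iff) auto
  then show "- ln (cylinder_length n x) \<le> log_expansion (n + 2) + ln 2"
    by (simp add: ln_orbit_prod_square_divide)
qed

section \<open>Matching a radius with orders of cylinders\<close>

definition scale_index :: "real \<Rightarrow> nat" where
  "scale_index r = (LEAST n. (orbit_prod (n + 3) x)\<^sup>2 / 4 \<le> r)"

text \<open>The least index exists because the orbit products tend to 0, and its minimality gives
  the strict upper bound. The offsets are such that \<open>ball_subset_cylinder\<close> puts the
  ball of radius \<open>r\<close> into the cylinder of order \<open>scale_index r\<close>.\<close>

lemma scale_index_bounds:
  assumes "0 < r" "r < (orbit_prod 2 x)\<^sup>2 / 4"
  shows "(orbit_prod (scale_index r + 3) x)\<^sup>2 / 4 \<le> r"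
    and "r < (orbit_prod (scale_index r + 2) x)\<^sup>2 / 4"
proof -
  have "(\<lambda>n. (orbit_prod n x)\<^sup>2 / 4) \<longlonglongrightarrow> 0"
    by (rule tendsto_eq_intros orbit_prod_tendsto_0 refl | simp)+
  from LIMSEQ_ignore_initial_segment[OF this, of 3]
  have "\<forall>\<^sub>F n in sequentially. (orbit_prod (n + 3) x)\<^sup>2 / 4 < r"
    using assms(1) by (rule order_tendstoD)
  then obtain n where "(orbit_prod (n + 3) x)\<^sup>2 / 4 < r"
    by (auto simp: eventually_sequentially)
  then have "(orbit_prod (n + 3) x)\<^sup>2 / 4 \<le> r" by simp
  then show "(orbit_prod (scale_index r + 3) x)\<^sup>2 / 4 \<le> r"
    unfolding scale_index_def by (rule LeastI)
  show "r < (orbit_prod (scale_index r + 2) x)\<^sup>2 / 4"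
  proof (cases "scale_index r")
    case (Suc k)
    then have "\<not> (orbit_prod (k + 3) x)\<^sup>2 / 4 \<le> r"
      unfolding scale_index_def using not_less_Least by (metis lessI)
    then show ?thesis using Suc by (simp add: numeral_eq_Suc)
  \<comment> \<open>Index 0 has no predecessor to compare with; here the upper bound is the
    assumption on \<open>r\<close>.\<close>
  qed (use assms in \<open>simp add: numeral_2_eq_2\<close>)
qed

lemma orbit_prod_square_pos: "0 < (orbit_prod n x)\<^sup>2 / 4"
  using orbit_prod_pos[of n] by simp

lemma filterlim_scale_index: "filterlim scale_index at_top (at_right 0)"
  unfolding filterlim_at_top
proof
  fix K
  show "\<forall>\<^sub>F r in at_right 0. K \<le> scale_index r"
    using eventually_at_right_0_less[OF orbit_prod_square_pos[of 2]]
      eventually_at_right_0_less[OF orbit_prod_square_pos[of "K + 3"]]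
  proof eventually_elim
    case (elim r)
    show ?case
    proof (rule ccontr)
      assume "\<not> K \<le> scale_index r"
      then have "(orbit_prod (K + 3) x)\<^sup>2 \<le> (orbit_prod (scale_index r + 3) x)\<^sup>2"
        using orbit_prod_pos[of "K + 3"] by (intro power_mono orbit_prod_antimono) auto
      then show False using scale_index_bounds(1)[of r] elim by simp
    qed
  qed
qed

text \<open>Four further orders shrink the orbit product by a factor of at least 4, hence its square
  by 16. This absorbs both the 1/4 in the choice of the index and the 2 in
  \<open>cylinder_subset_cball\<close>.\<close>

lemma cylinder_subset_ball_scale_index:
  assumes "0 < r" "r < (orbit_prod 2 x)\<^sup>2 / 4"
  shows "cylinder (scale_index r + 7) x \<subseteq> ball x r"
proof -
  define n where "n = scale_index r"
  define p where "p = orbit_prod (n + 7) x"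
  have p: "0 < p" unfolding p_def by (rule orbit_prod_pos)
  have "4 * p \<le> orbit_prod (n + 3) x"
    using orbit_prod_halves[of "n + 3"] orbit_prod_halves[of "n + 5"] by (simp add: p_def add.commute)
  then have "(4 * p)\<^sup>2 \<le> (orbit_prod (n + 3) x)\<^sup>2" using p by (intro power_mono) auto
  then have "4 * p\<^sup>2 \<le> r"
    using scale_index_bounds(1)[OF assms] by (simp add: n_def power_mult_distrib)
  moreover have "0 < p\<^sup>2" using p by simp
  ultimately have "2 * p\<^sup>2 < r" by linarith
  then have "cball x (2 * p\<^sup>2) \<subseteq> ball x r" by auto
  then show ?thesis using cylinder_subset_cball[of "n + 7"] by (simp add: n_def p_def)
qed

lemma ball_scale_index_subset_cylinder:
  assumes "0 < r" "r < (orbit_prod 2 x)\<^sup>2 / 4"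
  shows "ball x r \<subseteq> cylinder (scale_index r) x"
  using ball_subset_cylinder[of "scale_index r"] scale_index_bounds(2)[OF assms]
  by (auto simp: subset_iff)

lemma ln_scale_index_bounds:
  assumes "0 < r" "r < (orbit_prod 2 x)\<^sup>2 / 4"
  shows "log_expansion (scale_index r + 2) + ln 4 \<le> - ln r"
    and "- ln r \<le> log_expansion (scale_index r + 3) + ln 4"
proof -
  have "ln r \<le> ln ((orbit_prod (scale_index r + 2) x)\<^sup>2 / 4)"
    using scale_index_bounds(2)[OF assms] assms(1) orbit_prod_square_pos
    by (subst ln_le_cancel_iff) auto
  then show "log_expansion (scale_index r + 2) + ln 4 \<le> - ln r"
    by (simp add: ln_orbit_prod_square_divide)
  have "ln ((orbit_prod (scale_index r + 3) x)\<^sup>2 / 4) \<le> ln r"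
    using scale_index_bounds(1)[OF assms] assms(1) orbit_prod_square_pos
    by (subst ln_le_cancel_iff) auto
  then show "- ln r \<le> log_expansion (scale_index r + 3) + ln 4"
    by (simp add: ln_orbit_prod_square_divide)
qed

lemma log_expansion_nonneg: "0 \<le> log_expansion n"
  using orbit_prod_antimono[of 0 n] orbit_prod_pos[of n] by (simp add: log_expansion_def)

end

section \<open>Limits of extended real quotients of logarithms\<close>

lemma ext_ln_divide_ln: "ext_ln m / ereal t = (- ext_ln m) / ereal (- t)" if "t < 0"
  using that by (simp add: ext_ln_def divide_ereal_def)

lemma ext_ln_mono: "0 \<le> a \<Longrightarrow> a \<le> b \<Longrightarrow> ext_ln a \<le> ext_ln b"
  by (auto simp: ext_ln_def)

lemma ext_ln_nonpos: "0 \<le> a \<Longrightarrow> a \<le> 1 \<Longrightarrow> ext_ln a \<le> 0"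
  by (auto simp: ext_ln_def)

lemma ereal_frac_le:
  fixes f g :: ereal
  assumes "0 \<le> f" "f \<le> g" "0 < v" "v \<le> w"
  shows "f / ereal w \<le> g / ereal v"
proof -
  have "f / ereal w \<le> g / ereal w"
    using assms by (intro ereal_divide_right_mono) auto
  also have "g / ereal w \<le> g / ereal v"
    using assms unfolding divide_ereal_def
    by (intro ereal_mult_left_mono) (auto simp: le_imp_inverse_le)
  finally show ?thesis .
qed

text \<open>The new quotient is the old one times \<open>w n / v n\<close>, which tends to 1. As
  this limit is neither 0 nor infinite, the product rule also covers an infinite
  \<open>d\<close>.\<close>

lemma tendsto_ereal_divide_rescale:
  fixes f :: "nat \<Rightarrow> ereal"
  assumes lim: "(\<lambda>n. f n / ereal (w n)) \<longlonglongrightarrow> d"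
    and w: "(\<lambda>n. w n / real n) \<longlonglongrightarrow> l" and v: "(\<lambda>n. v n / real n) \<longlonglongrightarrow> l" and l: "0 < l"
  shows "(\<lambda>n. f n / ereal (v n)) \<longlonglongrightarrow> d"
proof -
  have "(\<lambda>n. (w n / real n) / (v n / real n)) \<longlonglongrightarrow> l / l"
    using w v l by (intro tendsto_divide) auto
  then have "(\<lambda>n. ereal ((w n / real n) / (v n / real n))) \<longlonglongrightarrow> ereal 1"
    using l by (simp only: lim_ereal divide_self[OF less_imp_neq[OF l, symmetric]])
  from tendsto_mult_ereal[OF lim this]
  have "(\<lambda>n. f n / ereal (w n) * ereal ((w n / real n) / (v n / real n))) \<longlonglongrightarrow> d * ereal 1"
    by simp
  moreover have "\<forall>\<^sub>F n in sequentially.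
      f n / ereal (w n) * ereal ((w n / real n) / (v n / real n)) = f n / ereal (v n)"
    using order_tendstoD(1)[OF w l] order_tendstoD(1)[OF v l] eventually_gt_at_top[of 0]
  proof eventually_elim
    case (elim n)
    then have "0 < w n" "0 < v n" by (simp_all add: zero_less_divide_iff)
    then show ?case using elim by (simp add: divide_ereal_def mult.assoc field_simps)
  qed
  ultimately show ?thesis by (simp add: filterlim_cong[OF refl refl])
qed

lemma tendsto_shift_divide_real:
  fixes a :: "nat \<Rightarrow> real"
  assumes "(\<lambda>n. a n / real n) \<longlonglongrightarrow> l"
  shows "(\<lambda>n. (a (n + k) + c) / real n) \<longlonglongrightarrow> l"
proof -
  have inv: "(\<lambda>n. 1 / real n) \<longlonglongrightarrow> 0" by (rule lim_1_over_n)
  have "(\<lambda>n. a (n + k) / real (n + k) * (1 + real k * (1 / real n)) + c * (1 / real n))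
      \<longlonglongrightarrow> l * (1 + real k * 0) + c * 0"
    by (intro tendsto_intros inv LIMSEQ_ignore_initial_segment[OF assms])
  moreover have "\<forall>\<^sub>F n in sequentially.
      a (n + k) / real (n + k) * (1 + real k * (1 / real n)) + c * (1 / real n)
      = (a (n + k) + c) / real n"
    using eventually_gt_at_top[of 0]
  proof eventually_elim
    case (elim n)
    then have "1 + real k * (1 / real n) = real (n + k) / real n" by (simp add: field_simps)
    then show ?case using elim by (simp add: add_divide_distrib del: of_nat_add)
  qed
  ultimately show ?thesis by (simp add: filterlim_cong[OF refl refl])
qed

text \<open>Logarithms of comparable positive values differ by at most a constant, which is
  negligible against \<open>ln (s n)\<close>. Where \<open>v n = 0\<close>, comparability eventually
  forces \<open>u n = 0\<close>, and the two quotients coincide.\<close>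

lemma tendsto_ext_ln_quotient_comparable:
  assumes uv: "comparable u v" and nonneg: "\<And>n. 0 \<le> v n"
    and pos: "\<And>n. 0 < s n" and s: "s \<longlonglongrightarrow> 0"
    and lim: "(\<lambda>n. ext_ln (u n) / ereal (ln (s n))) \<longlonglongrightarrow> d"
  shows "(\<lambda>n. ext_ln (v n) / ereal (ln (s n))) \<longlonglongrightarrow> d"
proof -
  obtain c1 c2 where c: "0 < c1" "0 < c2"
    and ev: "\<forall>\<^sub>F n in sequentially. c1 * v n \<le> u n \<and> u n \<le> c2 * v n"
    using uv by (auto simp: comparable_def)
  define C where "C = max \<bar>ln c1\<bar> \<bar>ln c2\<bar>"
  \<comment> \<open>The error is set to 0 at null values, so that an infinite quotient is left
    unchanged and the convention \<open>ln 0 = 0\<close> does not interfere.\<close>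
  define e where "e n = (if v n = 0 then 0 else (ln (v n) - ln (u n)) / ln (s n))" for n
  have small: "\<forall>\<^sub>F n in sequentially. s n < 1" using s by (rule order_tendstoD) simp
  have "filterlim s (at_right 0) sequentially"
    by (rule tendsto_imp_filterlim_at_right[OF s]) (simp add: pos)
  then have "filterlim (\<lambda>n. ln (s n)) at_bot sequentially"
    by (rule filterlim_compose[OF ln_at_0])
  then have "(\<lambda>n. C / ln (s n)) \<longlonglongrightarrow> 0"
    by (intro tendsto_divide_0[OF tendsto_const] filterlim_at_bot_imp_at_infinity)
  then have "(\<lambda>n. \<bar>C / ln (s n)\<bar>) \<longlonglongrightarrow> 0" by (rule tendsto_rabs_zero)
  moreover have "\<forall>\<^sub>F n in sequentially. norm (e n) \<le> \<bar>C / ln (s n)\<bar>"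
    using ev
  proof eventually_elim
    case (elim n)
    show ?case
    proof (cases "v n = 0")
      case False
      then have v: "0 < v n" using nonneg[of n] by simp
      then have u: "0 < u n" using elim c by (smt (verit) mult_pos_pos)
      have "ln (c1 * v n) \<le> ln (u n)" "ln (u n) \<le> ln (c2 * v n)"
        using elim v u c by (simp_all add: ln_le_cancel_iff)
      then have "\<bar>ln (v n) - ln (u n)\<bar> \<le> C" using c v by (auto simp: C_def ln_mult)
      then show ?thesis using False by (auto simp: e_def abs_divide intro!: divide_right_mono)
    qed (simp add: e_def)
  qed
  ultimately have "e \<longlonglongrightarrow> 0" by (rule Lim_null_comparison[rotated])
  then have "(\<lambda>n. ereal (e n)) \<longlonglongrightarrow> ereal 0" by (simp only: lim_ereal)
  from tendsto_add_ereal_general[OF _ lim this]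
  have "(\<lambda>n. ext_ln (u n) / ereal (ln (s n)) + ereal (e n)) \<longlonglongrightarrow> d" by simp
  moreover have "\<forall>\<^sub>F n in sequentially.
      ext_ln (u n) / ereal (ln (s n)) + ereal (e n) = ext_ln (v n) / ereal (ln (s n))"
    using ev small
  proof eventually_elim
    case (elim n)
    then have neg: "ln (s n) < 0" using pos[of n] by simp
    show ?case
    proof (cases "v n = 0")
      case True
      with elim have "u n = 0" by auto
      with True show ?thesis by (simp add: e_def)
    next
      case False
      then have v: "0 < v n" using nonneg[of n] by simp
      then have "0 < u n" using elim c by (smt (verit) mult_pos_pos)
      then show ?thesis using v neg by (simp add: ext_ln_def e_def diff_divide_distrib)
    qed
  qed
  ultimately show ?thesis by (simp add: filterlim_cong[OF refl refl])
qed

section \<open>Transfer of limits between balls and cylinders\<close>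

lemma pointwise_quotient_tendsto_of_markov:
  fixes M :: "real measure" and x :: real
  assumes M: "prob_space M" and sets: "sets M = sets (restrict_space borel {0..<1})"
    and x: "x \<in> {0..<1}" "x \<notin> \<rat>"
    and d: "markov_quotient M x \<longlonglongrightarrow> d" and lyap: "lyapunov_exists x"
  shows "(pointwise_quotient M x \<longlongrightarrow> d) (at_right 0)"
proof -
  interpret prob_space M by fact
  have space: "space M = {0..<1}"
    using sets_eq_imp_space_eq[OF sets] by (simp add: space_restrict_space)
  have cyl: "cylinder n x \<in> sets M" for n
    unfolding sets using cylinder_subset_unit[of n x] cylinder_borel[of n x]
    by (simp add: sets_restrict_space_iff)
  have ball: "ball x r \<inter> space M \<in> sets M" for r
    unfolding sets space by (simp add: sets_restrict_space_iff)
  define m where "m n = - ext_ln (measure M (cylinder n x))" for n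
  define W where "W n = - ln (cylinder_length n x)" for n
  obtain l where l: "0 < l" and L: "(\<lambda>n. log_expansion x n / real n) \<longlonglongrightarrow> l"
    using lyapunov_expansion[OF x lyap] by blast
  \<comment> \<open>The length bounds enclose \<open>W n\<close> between shifts of
    \<open>log_expansion\<close>, and a bounded shift of index or value preserves the linear rate
    \<open>l\<close>.\<close>
  have W: "(\<lambda>n. W n / real n) \<longlonglongrightarrow> l"
  proof (rule tendsto_sandwich)
    show "(\<lambda>n. (log_expansion x (n + 0) + - ln 4) / real n) \<longlonglongrightarrow> l"
      by (rule tendsto_shift_divide_real[OF L])
    show "(\<lambda>n. (log_expansion x (n + 2) + ln 2) / real n) \<longlonglongrightarrow> l"
      by (rule tendsto_shift_divide_real[OF L])
    show "\<forall>\<^sub>F n in sequentially. (log_expansion x (n + 0) + - ln 4) / real n \<le> W n / real n"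
      using log_cylinder_length_bounds(1)[OF x]
      by (intro always_eventually allI divide_right_mono) (simp_all add: W_def)
    show "\<forall>\<^sub>F n in sequentially. W n / real n \<le> (log_expansion x (n + 2) + ln 2) / real n"
      unfolding W_def
      by (intro always_eventually allI divide_right_mono log_cylinder_length_bounds(2)[OF x]) simp
  qed
  have "\<forall>\<^sub>F n in sequentially. cylinder_length n x < 1"
    using cylinder_length_tendsto_0[OF x] by (rule order_tendstoD) simp
  then have "\<forall>\<^sub>F n in sequentially. markov_quotient M x n = m n / ereal (W n)"
  proof eventually_elim
    case (elim n)
    then have "ln (cylinder_length n x) < 0" using cylinder_length_pos[OF x, of n] by simp
    then show ?case by (simp add: markov_quotient_def m_def W_def ext_ln_divide_ln)
  qed
  with d have mW: "(\<lambda>n. m n / ereal (W n)) \<longlonglongrightarrow> d" by (simp add: filterlim_cong[OF refl refl])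
  \<comment> \<open>Both bounding sequences are the Markov quotients with their denominators
    replaced by ones of the same rate \<open>l\<close>; the numerator of order \<open>n + 7\<close>
    still belongs to a denominator of rate \<open>l\<close> in \<open>n\<close>.\<close>
  have lower: "(\<lambda>n. m n / ereal (log_expansion x (n + 3) + ln 4)) \<longlonglongrightarrow> d"
    by (rule tendsto_ereal_divide_rescale[OF mW W tendsto_shift_divide_real[OF L] l])
  have upper: "(\<lambda>n. m (n + 7) / ereal (log_expansion x (n + 2) + ln 4)) \<longlonglongrightarrow> d"
    using tendsto_shift_divide_real[OF W, of 7 0]
    by (intro tendsto_ereal_divide_rescale[OF LIMSEQ_ignore_initial_segment[OF mW]
          _ tendsto_shift_divide_real[OF L] l]) simp
  have small: "\<forall>\<^sub>F r in at_right 0. 0 < r \<and> r < (orbit_prod 2 x)\<^sup>2 / 4"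
    by (rule eventually_at_right_0_less[OF orbit_prod_square_pos[OF x]])
  have bounds: "m (scale_index x r) / ereal (log_expansion x (scale_index x r + 3) + ln 4)
        \<le> pointwise_quotient M x r
      \<and> pointwise_quotient M x r
        \<le> m (scale_index x r + 7) / ereal (log_expansion x (scale_index x r + 2) + ln 4)"
    if r: "0 < r" "r < (orbit_prod 2 x)\<^sup>2 / 4" for r
  proof -
    define n where "n = scale_index x r"
    note ln = ln_scale_index_bounds[OF x r, folded n_def]
    have ln4: "0 < ln (4::real)" by simp
    have "0 \<le> log_expansion x (n + 2)" by (rule log_expansion_nonneg[OF x])
    with ln(1) ln4 have neg: "ln r < 0" and pos: "0 < log_expansion x (n + 2) + ln 4" by linarith+
    \<comment> \<open>Changing both signs yields a nonnegative numerator and a positive denominator,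
      as \<open>ereal_frac_le\<close> requires.\<close>
    have q: "pointwise_quotient M x r = (- ext_ln (ball_measure M x r)) / ereal (- ln r)"
      unfolding pointwise_quotient_def by (rule ext_ln_divide_ln[OF neg])
    have "measure M (cylinder (n + 7) x) \<le> ball_measure M x r"
      unfolding ball_measure_def
      using cylinder_subset_ball_scale_index[OF x r] cylinder_subset_unit[of "n + 7" x]
      by (intro finite_measure_mono ball) (auto simp: n_def space)
    then have m7: "- ext_ln (ball_measure M x r) \<le> m (n + 7)"
      by (simp add: m_def ext_ln_mono)
    have "ball_measure M x r \<le> measure M (cylinder n x)"
      unfolding ball_measure_def using ball_scale_index_subset_cylinder[OF x r]
      by (intro finite_measure_mono cyl) (auto simp: n_def)
    then have m0: "m n \<le> - ext_ln (ball_measure M x r)"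
      by (simp add: m_def ext_ln_mono ball_measure_def)
    have "0 \<le> m n" by (simp add: m_def ext_ln_nonpos ereal_0_le_uminus_iff)
    moreover from this have "0 \<le> - ext_ln (ball_measure M x r)" using m0 by (rule order_trans)
    moreover have "0 < - ln r" using neg by simp
    ultimately show ?thesis unfolding q n_def[symmetric]
      using ereal_frac_le[OF _ m0 _ ln(2)] ereal_frac_le[OF _ m7 pos ln(1)] by blast
  qed
  show ?thesis
  proof (rule tendsto_sandwich)
    show "\<forall>\<^sub>F r in at_right 0. m (scale_index x r) / ereal (log_expansion x (scale_index x r + 3) + ln 4)
        \<le> pointwise_quotient M x r"
      using small by eventually_elim (use bounds in blast)
    show "\<forall>\<^sub>F r in at_right 0. pointwise_quotient M x r
        \<le> m (scale_index x r + 7) / ereal (log_expansion x (scale_index x r + 2) + ln 4)"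
      using small by eventually_elim (use bounds in blast)
    show "((\<lambda>r. m (scale_index x r) / ereal (log_expansion x (scale_index x r + 3) + ln 4))
        \<longlongrightarrow> d) (at_right 0)"
      by (rule filterlim_compose[OF lower filterlim_scale_index[OF x]])
    show "((\<lambda>r. m (scale_index x r + 7) / ereal (log_expansion x (scale_index x r + 2) + ln 4))
        \<longlongrightarrow> d) (at_right 0)"
      by (rule filterlim_compose[OF upper filterlim_scale_index[OF x]])
  qed
qed

lemma markov_quotient_tendsto_of_pointwise:
  assumes x: "x \<in> {0..<1}" "x \<notin> \<rat>"
    and comp: "comparable (\<lambda>n. ball_measure M x (cylinder_length n x)) (\<lambda>n. measure M (cylinder n x))"
    and d: "(pointwise_quotient M x \<longlongrightarrow> d) (at_right 0)"
  shows "markov_quotient M x \<longlonglongrightarrow> d"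
proof -
  have "filterlim (\<lambda>n. cylinder_length n x) (at_right 0) sequentially"
    by (rule tendsto_imp_filterlim_at_right[OF cylinder_length_tendsto_0[OF x]])
      \<comment> \<open>Positivity of the lengths makes them admissible radii, so the limit over all
        radii can be taken along them.\<close>
      (simp add: cylinder_length_pos[OF x])
  from filterlim_compose[OF d this] show ?thesis
    unfolding markov_quotient_def[abs_def]
    by (intro tendsto_ext_ln_quotient_comparable[OF comp _ cylinder_length_pos[OF x]
          cylinder_length_tendsto_0[OF x]]) (simp_all add: pointwise_quotient_def)
qed

theorem lemma2p12:
  fixes M :: "real measure" and x :: real
  assumes "prob_space M"
    and "sets M = sets (restrict_space borel {0..<1})"
    and "x \<in> {0..<1}" and "x \<notin> \<rat>"
  shows "(comparable (\<lambda>n. ball_measure M x (cylinder_length n x)) (\<lambda>n. measure M (cylinder n x)) \<longrightarrow>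
            pointwise_dim_exists M x \<longrightarrow>
            markov_dim_exists M x \<and> markov_dim M x = pointwise_dim M x) \<and>
         (markov_dim_exists M x \<and> lyapunov_exists x \<longrightarrow>
            pointwise_dim_exists M x \<and> markov_dim M x = pointwise_dim M x)"
proof (intro conjI[of "_ \<longrightarrow> _"] impI)
  \<comment> \<open>A common limit \<open>d\<close> of both quotients yields existence and equality
    at once, by uniqueness of limits along the nontrivial filters involved.\<close>
  have dims: "markov_dim_exists M x \<and> pointwise_dim_exists M x \<and> markov_dim M x = pointwise_dim M x"
    if "markov_quotient M x \<longlonglongrightarrow> d" "(pointwise_quotient M x \<longlongrightarrow> d) (at_right 0)" for d
  proof -
    have "markov_dim M x = d" unfolding markov_dim_def using that(1) by (rule limI)
    moreover have "pointwise_dim M x = d"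
      unfolding pointwise_dim_def using that(2) by (intro tendsto_Lim) auto
    ultimately show ?thesis
      using that by (auto simp: markov_dim_exists_def pointwise_dim_exists_def convergent_def)
  qed
  show "markov_dim_exists M x \<and> markov_dim M x = pointwise_dim M x"
    if "comparable (\<lambda>n. ball_measure M x (cylinder_length n x)) (\<lambda>n. measure M (cylinder n x))"
      and "pointwise_dim_exists M x"
    using that dims markov_quotient_tendsto_of_pointwise[OF assms(3,4)]
    unfolding pointwise_dim_exists_def by blast
  show "pointwise_dim_exists M x \<and> markov_dim M x = pointwise_dim M x"
    if "markov_dim_exists M x \<and> lyapunov_exists x"
    using that dims pointwise_quotient_tendsto_of_markov[OF assms]
    unfolding markov_dim_exists_def convergent_def by blast
qed

end
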